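(* Let $\alpha$ be a positive rational number and let $\mathcal T_1,\mathcal T_2$ be factorization trees for $\alpha$ with $\mathcal T_1\cong\mathcal T_2$. If $\mathcal G_1$ and $\mathcal G_2$ are measure class graphs for $\mathcal T_1$ and $\mathcal T_2$, respectively, then $\mathcal G_1\cong\mathcal G_2$.
   Context: Write $\alpha=a/b$ with $a,b$ coprime positive integers. Let $p_1\ge\cdots\ge p_N$ be the primes dividing $ab$, listed with multiplicity. Put $\gamma(i)=1$ if $p_i\mid a$, $\gamma(i)=-1$ if $p_i\mid b$, and $\alpha_n=\prod_{i=1}^n p_i^{\gamma(i)}$ for $0\le n\le N$. A factorization of a positive rational $\beta$ is a sequence $(a_1/b_1,a_2/b_2,\dots)$ with $a_i,b_i$ positive integers, $a_i=b_i=1$ for all but finitely many $i$, $\prod_i a_i/b_i=\beta$, $\max\{a_i,b_i\}\ge\max\{a_{i+1},b_{i+1}\}$ for all $i$, and $\gcd(a_i,b_j)=1$ for all $i,j$. Let $\mathfrak F_\alpha$ be the set of factorizations of $\alpha_n$, $0\le n\le N$. For $0\le n<N$, a factorization $(a_i/b_i)$ of $\alpha_n$ is a direct subfactorization of a factorization $(c_i/d_i)$ of $\alpha_{n+1}$ if either $p_{n+1}\mid a$ and for some $k$: $d_i=b_i$ for all $i$, $c_i=a_i$ for $i\ne k$, $c_k=a_kp_{n+1}$; or $p_{n+1}\mid b$ and for some $k$: $c_i=a_i$ for all $i$, $d_i=b_i$ for $i\ne k$, $d_k=b_kp_{n+1}$. A digraph data structure for a set $X$ is a pair $(G,\mu)$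 with $G$ a digraph and $\mu:V(G)\to X$ a map. A factorization tree for $\alpha$ is a digraph data structure $(T,\nu)$ for $\mathfrak F_\alpha$ where $T$ is a rooted tree with edges from each vertex to its children, with parenting map $\phi$, such that: (1) root $r_0$ has $\nu(r_0)=(1,1,\dots)$; (2) if $n<N$ and $\nu(r)$ is a factorization of $\alpha_n$ then $r$ has a child; (3) $\nu(r)=\nu(s)$ and $\phi(r)=\phi(s)$ imply $r=s$; (4) for non-root $r$, $\nu(\phi(r))$ is a direct subfactorization of $\nu(r)$. For $\mathbf A=(a_1/b_1,a_2/b_2,\dots)$ set $m(\mathbf A)=(\log\max\{a_1,b_1\},\log\max\{a_2,b_2\},\dots)$. Two elements $\mathbf A,\mathbf B$ of $\mathfrak F_\alpha$ are measure equivalent, $\mathbf A\sim\mathbf B$, if they are factorizations of the same rational number and $m(\mathbf A)=m(\mathbf B)$. Let $\overline{\mathfrak F}_\alpha$ be the set of equivalence classes $[\mathbf A]$ and $f:\mathfrak F_\alpha\to\overline{\mathfrak F}_\alpha$, $f(\mathbf A)=[\mathbf A]$. A measure class graph for a factorization tree $\mathcal T=(T,\nu)$ is a digraph data structure $\mathcal G=(G,\mu)$ for $\overline{\mathfrak F}_\alpha$ such that $\mu$ is injective and there exists a surjective map $\pi:V(T)\to V(G)$ with: $(\pi(r),\pi(s))\in E(G)$ whenever $(r,s)\in E(T)$; $\mu(\pi(r))=f(\nu(r))$ for all $r$; and (faithfulness) for all $g,h\in\pi(V(T))$ with $(g,h)\in E(G)$ there is $(r,s)\in E(T)$ with $(\pi(r),\pi(s))=(g,h)$.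 For digraph data structures $(G_1,\mu_1),(G_2,\mu_2)$ for the same set, an isomorphism is a bijection $\tau:V(G_1)\to V(G_2)$ with $\mu_2\circ\tau=\mu_1$ and $(g,h)\in E(G_1)\iff(\tau(g),\tau(h))\in E(G_2)$; $\cong$ means one exists (this applies both to factorization trees and to measure class graphs). *)

theory Defs
  imports
    Complex_Main
    "HOL-Library.FuncSet"
    "HOL-Computational_Algebra.Primes"
    "Graph_Theory.Pair_Digraph"
begin

text \<open>
  A positive rational \<open>\<alpha>\<close> is written in lowest terms as \<open>rat_num \<alpha> / rat_den \<alpha>\<close>.
  Prime lists and sequences are indexed from 0: the \<open>i\<close>-th prime \<open>p\<^sub>i\<close> of the
  mathematical text is \<open>rat_primes \<alpha> ! (i - 1)\<close>.
\<close>

definition rat_num :: "rat \<Rightarrow> nat" where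
  "rat_num \<alpha> = nat (fst (quotient_of \<alpha>))"

definition rat_den :: "rat \<Rightarrow> nat" where
  "rat_den \<alpha> = nat (snd (quotient_of \<alpha>))"

definition rat_primes :: "rat \<Rightarrow> nat list" where
  "rat_primes \<alpha> =
     rev (sorted_list_of_multiset (prime_factorization (rat_num \<alpha> * rat_den \<alpha>)))"

definition num_primes :: "rat \<Rightarrow> nat" where
  "num_primes \<alpha> = length (rat_primes \<alpha>)"

definition prime_sign :: "rat \<Rightarrow> nat \<Rightarrow> int" where
  "prime_sign \<alpha> i = (if rat_primes \<alpha> ! i dvd rat_num \<alpha> then 1 else -1)"

definition partial_rat :: "rat \<Rightarrow> nat \<Rightarrow> rat" where
  "partial_rat \<alpha> n = (\<Prod>i<n. of_nat (rat_primes \<alpha> ! i) powi prime_sign \<alpha> i)"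


text \<open>
  The entry \<open>a\<^sub>i/b\<^sub>i\<close> of a factorization is the pair \<open>(a\<^sub>i, b\<^sub>i)\<close>; as \<open>a\<^sub>i\<close> and \<open>b\<^sub>i\<close> are
  coprime, the pair carries the same information as the rational number.
\<close>

type_synonym frac_seq = "nat \<Rightarrow> nat \<times> nat"

definition factorization :: "rat \<Rightarrow> frac_seq \<Rightarrow> bool" where
  "factorization \<beta> A \<longleftrightarrow>
     (\<forall>i. fst (A i) > 0 \<and> snd (A i) > 0) \<and>
     finite {i. A i \<noteq> (1, 1)} \<and>
     (\<Prod>i | A i \<noteq> (1, 1). of_nat (fst (A i)) / of_nat (snd (A i))) = \<beta> \<and>
     (\<forall>i. max (fst (A i)) (snd (A i)) \<ge> max (fst (A (Suc i))) (snd (A (Suc i)))) \<and>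
     (\<forall>i j. gcd (fst (A i)) (snd (A j)) = 1)"

definition factorizations :: "rat \<Rightarrow> frac_seq set" where
  "factorizations \<alpha> = {A. \<exists>n\<le>num_primes \<alpha>. factorization (partial_rat \<alpha> n) A}"

definition direct_subfactorization :: "rat \<Rightarrow> frac_seq \<Rightarrow> frac_seq \<Rightarrow> bool" where
  "direct_subfactorization \<alpha> A C \<longleftrightarrow>
     (\<exists>n<num_primes \<alpha>.
        factorization (partial_rat \<alpha> n) A \<and>
        factorization (partial_rat \<alpha> (Suc n)) C \<and>
        ((rat_primes \<alpha> ! n dvd rat_num \<alpha> \<and>
          (\<exists>k. (\<forall>i. snd (C i) = snd (A i)) \<and>
               (\<forall>i. i \<noteq> k \<longrightarrow> fst (C i) = fst (A i)) \<and>
               fst (C k) = fst (A k) * rat_primes \<alpha> ! n)) \<or>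
         (rat_primes \<alpha> ! n dvd rat_den \<alpha> \<and>
          (\<exists>k. (\<forall>i. fst (C i) = fst (A i)) \<and>
               (\<forall>i. i \<noteq> k \<longrightarrow> snd (C i) = snd (A i)) \<and>
               snd (C k) = snd (A k) * rat_primes \<alpha> ! n))))"


text \<open>
  A digraph has at most one edge between an ordered pair of vertices; no finiteness or
  loop-freeness is imposed.
\<close>

type_synonym ('v, 'x) digraph_data = "'v pair_pre_digraph \<times> ('v \<Rightarrow> 'x)"

definition digraph_data_structure :: "'x set \<Rightarrow> ('v, 'x) digraph_data \<Rightarrow> bool" where
  "digraph_data_structure X = (\<lambda>(G, \<mu>). pair_wf_digraph G \<and> \<mu> \<in> pverts G \<rightarrow> X)"

definition digraph_data_iso ::
    "('v, 'x) digraph_data \<Rightarrow> ('w, 'x) digraph_data \<Rightarrow> bool" where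
  "digraph_data_iso = (\<lambda>(G1, \<mu>1) (G2, \<mu>2).
     \<exists>\<tau>. bij_betw \<tau> (pverts G1) (pverts G2) \<and>
         (\<forall>g\<in>pverts G1. \<mu>2 (\<tau> g) = \<mu>1 g) \<and>
         (\<forall>g\<in>pverts G1. \<forall>h\<in>pverts G1.
            (g, h) \<in> parcs G1 \<longleftrightarrow> (\<tau> g, \<tau> h) \<in> parcs G2))"

text \<open>
  A rooted tree with all edges directed away from the root: every vertex is the end of
  exactly one directed walk from the root. In particular the root has no incoming edge
  and every other vertex has exactly one.
\<close>

definition rooted_tree :: "'v pair_pre_digraph \<Rightarrow> 'v \<Rightarrow> bool" where
  "rooted_tree T r \<longleftrightarrow>
     pair_wf_digraph T \<and> r \<in> pverts T \<and>
     (\<forall>v\<in>pverts T. \<exists>!p. pre_digraph.awalk (with_proj T) r p v)"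

text \<open>The parent is meaningful for vertices other than the root only.\<close>

definition parent :: "'v pair_pre_digraph \<Rightarrow> 'v \<Rightarrow> 'v" where
  "parent T v = (THE u. (u, v) \<in> parcs T)"

definition factorization_tree :: "rat \<Rightarrow> ('v, frac_seq) digraph_data \<Rightarrow> bool" where
  "factorization_tree \<alpha> = (\<lambda>(T, \<nu>).
     digraph_data_structure (factorizations \<alpha>) (T, \<nu>) \<and>
     (\<exists>r0. rooted_tree T r0 \<and>
        \<nu> r0 = (\<lambda>i. (1, 1)) \<and>
        (\<forall>r\<in>pverts T. \<forall>n<num_primes \<alpha>.
           factorization (partial_rat \<alpha> n) (\<nu> r) \<longrightarrow> (\<exists>s\<in>pverts T. (r, s) \<in> parcs T)) \<and>
        (\<forall>r\<in>pverts T - {r0}. \<forall>s\<in>pverts T - {r0}.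
           \<nu> r = \<nu> s \<and> parent T r = parent T s \<longrightarrow> r = s) \<and>
        (\<forall>r\<in>pverts T - {r0}. direct_subfactorization \<alpha> (\<nu> (parent T r)) (\<nu> r))))"


definition log_measure :: "frac_seq \<Rightarrow> nat \<Rightarrow> real" where
  "log_measure A i = ln (real (max (fst (A i)) (snd (A i))))"

definition measure_equiv :: "rat \<Rightarrow> (frac_seq \<times> frac_seq) set" where
  "measure_equiv \<alpha> =
     {(A, B). A \<in> factorizations \<alpha> \<and> B \<in> factorizations \<alpha> \<and>
        (\<exists>\<beta>. factorization \<beta> A \<and> factorization \<beta> B) \<and> log_measure A = log_measure B}"

lemma equiv_measure_equiv: "equiv (factorizations \<alpha>) (measure_equiv \<alpha>)"
proof (rule equivI)
  show "measure_equiv \<alpha> \<subseteq> factorizations \<alpha> \<times> factorizations \<alpha>"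
    by (auto simp: measure_equiv_def)
  show "refl_on (factorizations \<alpha>) (measure_equiv \<alpha>)"
    by (auto simp: refl_on_def measure_equiv_def factorizations_def)
  show "sym (measure_equiv \<alpha>)"
    by (auto simp: sym_def measure_equiv_def)
  show "trans (measure_equiv \<alpha>)"
    unfolding trans_def measure_equiv_def factorization_def by auto
qed

definition measure_classes :: "rat \<Rightarrow> frac_seq set set" where
  "measure_classes \<alpha> = factorizations \<alpha> // measure_equiv \<alpha>"

definition measure_class :: "rat \<Rightarrow> frac_seq \<Rightarrow> frac_seq set" where
  "measure_class \<alpha> A = measure_equiv \<alpha> `` {A}"

definition measure_class_graph ::
    "rat \<Rightarrow> ('v, frac_seq) digraph_data \<Rightarrow> ('g, frac_seq set) digraph_data \<Rightarrow> bool" where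
  "measure_class_graph \<alpha> = (\<lambda>(T, \<nu>) (G, \<mu>).
     digraph_data_structure (measure_classes \<alpha>) (G, \<mu>) \<and>
     inj_on \<mu> (pverts G) \<and>
     (\<exists>\<pi>. \<pi> ` pverts T = pverts G \<and>
        (\<forall>r s. (r, s) \<in> parcs T \<longrightarrow> (\<pi> r, \<pi> s) \<in> parcs G) \<and>
        (\<forall>r\<in>pverts T. \<mu> (\<pi> r) = measure_class \<alpha> (\<nu> r)) \<and>
        (\<forall>g\<in>\<pi> ` pverts T. \<forall>h\<in>\<pi> ` pverts T. (g, h) \<in> parcs G \<longrightarrow>
           (\<exists>(r, s)\<in>parcs T. (\<pi> r, \<pi> s) = (g, h)))))"

end

theory Submission
  imports Defs
begin

text \<open>
  A measure class graph is determined by its tree up to isomorphism: its labels are exactly the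
  classes of the labels of the tree vertices, and, \<open>\<mu>\<close> being injective, two vertices are adjacent
  iff some tree edge carries labels in their two classes. Both sets of labels are unchanged under
  an isomorphism of trees, so matching vertices of equal label is an isomorphism of the graphs.
\<close>

text \<open>Labels, unlike vertices, live in a common type, so these sets can be compared across
  structures whose vertex types differ.\<close>

definition vertex_labels :: "('v, 'x) digraph_data \<Rightarrow> 'x set" where
  "vertex_labels D = snd D ` pverts (fst D)"

definition edge_labels :: "('v, 'x) digraph_data \<Rightarrow> ('x \<times> 'x) set" where
  "edge_labels D = map_prod (snd D) (snd D) ` parcs (fst D)"

lemma iso_vertex_labels:
  assumes "digraph_data_iso D1 D2"
  shows "vertex_labels D1 = vertex_labels D2"
proof -
  obtain \<tau> where "bij_betw \<tau> (pverts (fst D1)) (pverts (fst D2))"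
    and lab: "\<forall>g\<in>pverts (fst D1). snd D2 (\<tau> g) = snd D1 g"
    using assms by (auto simp: digraph_data_iso_def split_beta)
  then have "pverts (fst D2) = \<tau> ` pverts (fst D1)"
    by (simp add: bij_betw_def)
  with lab show ?thesis
    by (simp add: vertex_labels_def image_image)
qed

text \<open>An isomorphism constrains \<open>parcs\<close> only on pairs of vertices.
  Well-formedness places the ends of every arc among the vertices, so that \<tau> carries the arcs
  of \<open>D1\<close> exactly onto those of \<open>D2\<close>, with labels preserved.\<close>

lemma iso_edge_labels:
  assumes "digraph_data_iso D1 D2"
    and wf1: "pair_wf_digraph (fst D1)" and wf2: "pair_wf_digraph (fst D2)"
  shows "edge_labels D1 = edge_labels D2"
proof -
  obtain \<tau> where bij: "bij_betw \<tau> (pverts (fst D1)) (pverts (fst D2))"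
    and lab: "\<forall>g\<in>pverts (fst D1). snd D2 (\<tau> g) = snd D1 g"
    and arc: "\<forall>g\<in>pverts (fst D1). \<forall>h\<in>pverts (fst D1).
      (g, h) \<in> parcs (fst D1) \<longleftrightarrow> (\<tau> g, \<tau> h) \<in> parcs (fst D2)"
    using assms(1) by (auto simp: digraph_data_iso_def split_beta)
  have V1: "g \<in> pverts (fst D1) \<and> h \<in> pverts (fst D1)" if "(g, h) \<in> parcs (fst D1)" for g h
    using pair_wf_digraph.in_arcsD1[OF wf1 that] pair_wf_digraph.in_arcsD2[OF wf1 that] by simp
  have V2: "g \<in> pverts (fst D2) \<and> h \<in> pverts (fst D2)" if "(g, h) \<in> parcs (fst D2)" for g h
    using pair_wf_digraph.in_arcsD1[OF wf2 that] pair_wf_digraph.in_arcsD2[OF wf2 that] by simp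
  have "parcs (fst D2) = map_prod \<tau> \<tau> ` parcs (fst D1)"
  proof (intro equalityI subrelI)
    \<comment> \<open>Surjectivity of \<tau> pulls both ends back to \<open>D1\<close>; the arc
      between them then comes from the reverse direction of \<open>arc\<close>.\<close>
    fix u v assume uv: "(u, v) \<in> parcs (fst D2)"
    with V2 bij obtain g h where "g \<in> pverts (fst D1)" "h \<in> pverts (fst D1)" "u = \<tau> g" "v = \<tau> h"
      unfolding bij_betw_def by blast
    with uv arc show "(u, v) \<in> map_prod \<tau> \<tau> ` parcs (fst D1)"
      by force
  qed (use arc V1 in auto)
  then have "edge_labels D2 =
      (\<lambda>(g, h). (snd D2 (\<tau> g), snd D2 (\<tau> h))) ` parcs (fst D1)"
    by (force simp: edge_labels_def)
  also have "\<dots> = edge_labels D1"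
    unfolding edge_labels_def using lab V1 by (intro image_cong) auto
  finally show ?thesis ..
qed

text \<open>An edge label only says that some arc carries the two given labels; injectivity of the
  labelling forces the ends of that arc to be \<open>g\<close> and \<open>h\<close>.\<close>

lemma arc_iff_edge_label:
  assumes inj: "inj_on (snd D) (pverts (fst D))" and wf: "pair_wf_digraph (fst D)"
    and g: "g \<in> pverts (fst D)" and h: "h \<in> pverts (fst D)"
  shows "(g, h) \<in> parcs (fst D) \<longleftrightarrow> (snd D g, snd D h) \<in> edge_labels D"
proof
  assume "(snd D g, snd D h) \<in> edge_labels D"
  then obtain u v where uv: "(u, v) \<in> parcs (fst D)" "snd D u = snd D g" "snd D v = snd D h"
    by (auto simp: edge_labels_def)
  then have "u = g" "v = h"
    using inj_onD[OF inj] pair_wf_digraph.in_arcsD1[OF wf] pair_wf_digraph.in_arcsD2[OF wf] g h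
    by blast+
  with uv(1) show "(g, h) \<in> parcs (fst D)"
    by simp
qed (force simp: edge_labels_def)

text \<open>A converse to the two preceding invariance results for injective labellings. It applies
  to measure class graphs, but not to trees in general, where different vertices may share a
  label.\<close>

lemma digraph_data_isoI:
  assumes inj1: "inj_on (snd D1) (pverts (fst D1))" and inj2: "inj_on (snd D2) (pverts (fst D2))"
    and wf1: "pair_wf_digraph (fst D1)" and wf2: "pair_wf_digraph (fst D2)"
    and V: "vertex_labels D1 = vertex_labels D2" and E: "edge_labels D1 = edge_labels D2"
  shows "digraph_data_iso D1 D2"
proof -
  \<comment> \<open>\<tau> sends a vertex to the unique vertex of \<open>D2\<close> with the same
    label; it exists because the vertex labels agree.\<close>
  define \<tau> where "\<tau> = inv_into (pverts (fst D2)) (snd D2) \<circ> snd D1"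
  have bij: "bij_betw \<tau> (pverts (fst D1)) (pverts (fst D2))"
    unfolding \<tau>_def
  proof (rule bij_betw_trans)
    show "bij_betw (snd D1) (pverts (fst D1)) (vertex_labels D1)"
      using inj1 by (simp add: bij_betw_def vertex_labels_def)
    show "bij_betw (inv_into (pverts (fst D2)) (snd D2)) (vertex_labels D1) (pverts (fst D2))"
      unfolding V using inj2 by (intro bij_betw_inv_into) (simp add: bij_betw_def vertex_labels_def)
  qed
  have lab: "snd D2 (\<tau> g) = snd D1 g" if "g \<in> pverts (fst D1)" for g
  proof -
    have "snd D1 g \<in> snd D2 ` pverts (fst D2)"
      using that V by (auto simp: vertex_labels_def)
    then show ?thesis
      by (simp add: \<tau>_def f_inv_into_f)
  qed
  have "(g, h) \<in> parcs (fst D1) \<longleftrightarrow> (\<tau> g, \<tau> h) \<in> parcs (fst D2)"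
    if g: "g \<in> pverts (fst D1)" and h: "h \<in> pverts (fst D1)" for g h
    using arc_iff_edge_label[OF inj1 wf1 g h] arc_iff_edge_label[OF inj2 wf2, of "\<tau> g" "\<tau> h"] lab[OF g]
      lab[OF h] E bij_betwE[OF bij] g h by simp
  with bij lab show ?thesis
    by (auto simp: digraph_data_iso_def split_beta)
qed

text \<open>The choice of \<pi> disappears from the conclusions: \<pi> maps vertices onto vertices
  and arcs onto arcs, and the label of \<open>\<pi> r\<close> depends only on the label of
  \<open>r\<close>.\<close>

lemma measure_class_graph_labels:
  assumes wf: "pair_wf_digraph (fst T)" and mcg: "measure_class_graph \<alpha> T G"
  shows "vertex_labels G = measure_class \<alpha> ` vertex_labels T"
    and "edge_labels G = map_prod (measure_class \<alpha>) (measure_class \<alpha>) ` edge_labels T"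
proof -
  have wfG: "pair_wf_digraph (fst G)"
    using mcg by (auto simp: measure_class_graph_def digraph_data_structure_def split_beta)
  obtain \<pi> where sur: "pverts (fst G) = \<pi> ` pverts (fst T)"
    and hom: "\<forall>r s. (r, s) \<in> parcs (fst T) \<longrightarrow> (\<pi> r, \<pi> s) \<in> parcs (fst G)"
    and lab: "\<forall>r\<in>pverts (fst T). snd G (\<pi> r) = measure_class \<alpha> (snd T r)"
    and faithful: "\<forall>g\<in>\<pi> ` pverts (fst T). \<forall>h\<in>\<pi> ` pverts (fst T). (g, h) \<in> parcs (fst G) \<longrightarrow>
      (\<exists>(r, s)\<in>parcs (fst T). (\<pi> r, \<pi> s) = (g, h))"
    using mcg unfolding measure_class_graph_def case_prod_beta[of _ T] case_prod_beta[of _ G]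
    by (elim conjE exE) (rule that, erule sym)
  show "vertex_labels G = measure_class \<alpha> ` vertex_labels T"
    by (auto simp: vertex_labels_def sur image_image lab)
  have "parcs (fst G) = map_prod \<pi> \<pi> ` parcs (fst T)"
  proof (intro equalityI subrelI)
    fix g h assume gh: "(g, h) \<in> parcs (fst G)"
    have "g \<in> pverts (fst G)" "h \<in> pverts (fst G)"
      using pair_wf_digraph.in_arcsD1[OF wfG gh] pair_wf_digraph.in_arcsD2[OF wfG gh] by auto
    \<comment> \<open>Faithfulness concerns only arcs between vertices in the image of \<pi>; by
      surjectivity these are all arcs of \<open>G\<close>.\<close>
    with faithful gh obtain r s where "(r, s) \<in> parcs (fst T)" "\<pi> r = g" "\<pi> s = h"
      unfolding sur by blast
    then show "(g, h) \<in> map_prod \<pi> \<pi> ` parcs (fst T)"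
      by force
  qed (use hom in auto)
  then have "edge_labels G = (\<lambda>(r, s). (snd G (\<pi> r), snd G (\<pi> s))) ` parcs (fst T)"
    by (force simp: edge_labels_def)
  also have "\<dots> = (\<lambda>(r, s). (measure_class \<alpha> (snd T r), measure_class \<alpha> (snd T s))) ` parcs (fst T)"
    using pair_wf_digraph.in_arcsD1[OF wf] pair_wf_digraph.in_arcsD2[OF wf]
    by (intro image_cong) (auto simp: lab)
  also have "\<dots> = map_prod (measure_class \<alpha>) (measure_class \<alpha>) ` edge_labels T"
    by (force simp: edge_labels_def)
  finally show "edge_labels G = map_prod (measure_class \<alpha>) (measure_class \<alpha>) ` edge_labels T" .
qed

theorem theorem2p11:
  fixes \<alpha> :: rat
    and T1 :: "('v1, frac_seq) digraph_data" and T2 :: "('v2, frac_seq) digraph_data"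
    and G1 :: "('g1, frac_seq set) digraph_data" and G2 :: "('g2, frac_seq set) digraph_data"
  assumes "\<alpha> > 0"
    and "factorization_tree \<alpha> T1" and "factorization_tree \<alpha> T2"
    and "digraph_data_iso T1 T2"
    and "measure_class_graph \<alpha> T1 G1" and "measure_class_graph \<alpha> T2 G2"
  shows "digraph_data_iso G1 G2"
proof -
  have wf: "pair_wf_digraph (fst T1)" "pair_wf_digraph (fst T2)"
    using assms(2,3) by (auto simp: factorization_tree_def digraph_data_structure_def split_beta)
  have G: "inj_on (snd G1) (pverts (fst G1))" "inj_on (snd G2) (pverts (fst G2))"
    "pair_wf_digraph (fst G1)" "pair_wf_digraph (fst G2)"
    using assms(5,6) by (auto simp: measure_class_graph_def digraph_data_structure_def split_beta)
  show ?thesis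
    by (intro digraph_data_isoI[OF G])
      \<comment> \<open>Both label sets of each graph become images of those of its tree, and the
        tree isomorphism identifies the latter.\<close>
      (simp_all add: measure_class_graph_labels[OF wf(1) assms(5)]
        measure_class_graph_labels[OF wf(2) assms(6)]
        iso_vertex_labels[OF assms(4)] iso_edge_labels[OF assms(4) wf])
qed

end
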